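(* Let $0<\alpha\le \pi/2$, let $\Delta=\Delta(\alpha)=\{re^{i\theta} : r\ge 0,\ |\theta|\le\alpha\}$, and let $\{T_t\}_{t\in\Delta}$ be a $C_0$-semigroup on a separable Banach space $X$. Assume there exist a dense subset $X_0\subset X$ and mappings $S_t: X_0\to X$ for $t\in\Delta$ such that the following conditions hold for all $x\in X_0$: (i) For any $\epsilon>0$ there exists a real number $r_\epsilon>0$ such that $$\sup\left\{\left\|\sum_{n\in J}T_{\lambda_n}S_{\mu_n}x\right\| : J \text{ is a finite set},\ |\gamma_n|\ge r_\epsilon, \text{ and } |\gamma_n-\gamma_m|\ge 1,\ \forall n\ne m\right\}<\epsilon,$$ where $\lambda_n,\mu_n\in\Delta$ and $\gamma_n:=|\lambda_n-\mu_n|$. (ii) $T_tS_tx\to x$ as $t\to\infty$ (that is, as $|t|\to\infty$ with $t\in\Delta$). Then the semigroup $\{T_t\}_{t\in\Delta}$ is frequently hypercyclic.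
   Context: A $C_0$-semigroup $\{T_t\}_{t\in\Delta}$ on a Banach space $X$ is a family of bounded linear operators on $X$ with $T_0=I$, $T_{t+s}=T_tT_s$ for all $s,t\in\Delta$, and $\lim_{s\to t}T_sx=T_tx$ for all $x\in X$, $t\in\Delta$. Let $m$ be Lebesgue measure on the plane and $\Delta_t:=\{s\in\Delta : |s|\le t\}$ for $t>0$. The lower density of a measurable set $A\subset\Delta$ is $$\underline{D}(A):=\liminf_{t\to\infty}\frac{m(A\cap\Delta_t)}{m(\Delta_t)}=\liminf_{t\to\infty}\frac{m(A\cap\Delta_t)}{\alpha t^2}.$$ A $C_0$-semigroup $\{T_t\}_{t\in\Delta}$ on $X$ is frequently hypercyclic if there exists $x\in X$ such that $\underline{D}(\{t\in\Delta : T_tx\in U\})>0$ for every non-empty open set $U\subset X$.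
   Formalization: In (i), γ_n is taken to be the complex number λ_n−μ_n instead of its modulus |λ_n−μ_n|, so the points rather than the moduli are 1-separated; with moduli the claim is false (translations on L¹ of the sector with weight (1+|x|)^(-3/2)). *)

theory Defs
  imports "HOL-Analysis.Analysis"
begin

definition sector :: "real \<Rightarrow> complex set" where
  "sector \<alpha> = {complex_of_real r * cis \<theta> | r \<theta>. 0 \<le> r \<and> \<bar>\<theta>\<bar> \<le> \<alpha>}"

text \<open>Only the values \<open>T t\<close> with \<open>t \<in> \<Delta>\<close> matter. Banach spaces are real here; a complex
  Banach space with complex-linear operators is covered by forgetting the complex structure,
  since none of the notions below refers to scalars other than through linearity.\<close>

definition C0_semigroup :: "complex set \<Rightarrow> (complex \<Rightarrow> 'a \<Rightarrow> 'a::banach) \<Rightarrow> bool" where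
  "C0_semigroup \<Delta> T \<longleftrightarrow>
     (\<forall>t\<in>\<Delta>. bounded_linear (T t)) \<and>
     T 0 = id \<and>
     (\<forall>t\<in>\<Delta>. \<forall>s\<in>\<Delta>. T (t + s) = T t \<circ> T s) \<and>
     (\<forall>x. \<forall>t\<in>\<Delta>. ((\<lambda>s. T s x) \<longlongrightarrow> T t x) (at t within \<Delta>))"

definition lower_density :: "complex set \<Rightarrow> complex set \<Rightarrow> ereal" where
  "lower_density \<Delta> A =
     Liminf at_top (\<lambda>t::real.
       ereal (measure lebesgue (A \<inter> {s\<in>\<Delta>. cmod s \<le> t}) / measure lebesgue {s\<in>\<Delta>. cmod s \<le> t}))"

definition frequently_hypercyclic ::
    "complex set \<Rightarrow> (complex \<Rightarrow> 'a \<Rightarrow> 'a::banach) \<Rightarrow> bool" where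
  "frequently_hypercyclic \<Delta> T \<longleftrightarrow>
     (\<exists>x. \<forall>U. open U \<and> U \<noteq> {} \<longrightarrow> lower_density \<Delta> {t\<in>\<Delta>. T t x \<in> U} > 0)"

text \<open>The norms of the finite sums \<open>\<Sum>\<^sub>n T\<^bsub>\<lambda>\<^sub>n\<^esub> S\<^bsub>\<mu>\<^sub>n\<^esub> x\<close> admitted in the criterion for a
  given radius \<open>r\<close>. The differences \<open>\<gamma>\<^sub>n = \<lambda>\<^sub>n - \<mu>\<^sub>n\<close> are points of the plane, and it is these points,
  not merely their moduli, that are required to be 1-separated. Asking for 1-separated moduli would
  admit too few sums: translation on the weighted space \<open>L\<^sup>1\<close> over the sector with weight
  \<open>(1 + |x|) powr (- 3/2)\<close> would then satisfy the criterion (with \<open>S\<^sub>t\<close> the shift of compactly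
  supported functions by \<open>t\<close>), although it is not frequently hypercyclic.\<close>

definition separated_sum_norms ::
    "complex set \<Rightarrow> (complex \<Rightarrow> 'a \<Rightarrow> 'a) \<Rightarrow> (complex \<Rightarrow> 'a \<Rightarrow> 'a) \<Rightarrow> real \<Rightarrow>
     'a::banach \<Rightarrow> ereal set" where
  "separated_sum_norms \<Delta> T S r x =
     {ereal (norm (\<Sum>n\<in>J. T (l n) (S (\<mu> n) x))) |
        (J :: nat set) (l :: nat \<Rightarrow> complex) (\<mu> :: nat \<Rightarrow> complex) (\<gamma> :: nat \<Rightarrow> complex).
        finite J \<and>
        (\<forall>n\<in>J. l n \<in> \<Delta> \<and> \<mu> n \<in> \<Delta> \<and> \<gamma> n = l n - \<mu> n \<and> cmod (\<gamma> n) \<ge> r) \<and>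
        (\<forall>n\<in>J. \<forall>m\<in>J. n \<noteq> m \<longrightarrow> cmod (\<gamma> n - \<gamma> m) \<ge> 1)}"

end

theory Submission
  imports Defs
begin

text \<open>
  The vector with a frequently recurring orbit is written down explicitly. Let \<open>x 0, x 1, \<dots>\<close> be a sequence
  in the dense set \<open>X\<^sub>0\<close> that visits every ball infinitely often. Choose sets \<open>A k\<close> of points in the
  sector and put \<open>h = (\<Sum>k. \<Sum>\<mu>\<in>A k. S \<mu> (x k))\<close>. At a time \<open>z \<in> A k\<close> the orbit is
  \<open>T z h = T z (S z (x k)) + (\<Sum>\<dots> T z (S \<mu> (x l)))\<close>, where the last sum is over all other pairs
  \<open>\<mu> \<in> A l\<close>. The first term is close to \<open>x k\<close> if \<open>z\<close> is large, by condition (ii). The remaining sum is small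
  by condition (i) if all other points \<open>\<mu>\<close> are far from \<open>z\<close>, where how far depends on \<open>k\<close> and \<open>l\<close>:
  the bounds \<open>4 ^ - max k l\<close> for the part with label \<open>l\<close> add up to at most \<open>2 * 2 ^ - k\<close>. The same estimate at
  time \<open>0\<close> gives the convergence of the sum that defines \<open>h\<close>.

  Two facts remain. The sets \<open>A k\<close> must satisfy arbitrarily strong separation requirements \<open>N k + N l\<close> and
  still have at least of order \<open>R\<^sup>2\<close> points up to radius \<open>R\<close>
  (\<open>separated_planar_sets_exist\<close>). They come from a one-dimensional construction in which label \<open>k\<close> is attached
  to the indices with a certain \<open>2\<close>-adic valuation, so rare that even large distances cost only a
  bounded amount on average. Moreover, visits at isolated times must become visits during
  sets of positive area. The operators \<open>T s\<close> with \<open>\<bar>s\<bar> \<le> 1\<close> are uniformly bounded and \<open>T s (x k)\<close> tends to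
  \<open>x k\<close> as \<open>s\<close> tends to \<open>0\<close>, so every visit at a time \<open>z \<in> A k\<close> lasts for all \<open>z + s\<close> with
  small \<open>s\<close>, of a size that depends only on \<open>k\<close> and the target (\<open>lower_density_pos_of_separated_translates\<close>).
\<close>

section \<open>Separated point sets of positive density\<close>

text \<open>Odd indices contribute \<open>1\<close>, and halving an even index lowers its \<open>2\<close>-adic valuation by one.\<close>

lemma ruler_power_sum_double:
  fixes c :: real
  shows "(\<Sum>i=1..2*m. c ^ multiplicity 2 (i::nat)) = real m + c * (\<Sum>i=1..m. c ^ multiplicity 2 (i::nat))"
proof (induction m)
  case (Suc m)
  have odd: "multiplicity 2 (Suc (2 * m)) = 0"
    by (rule not_dvd_imp_multiplicity_0) simp
  have even: "multiplicity 2 (Suc (Suc (2 * m))) = Suc (multiplicity 2 (Suc m))"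
    using multiplicity_times_same[of "Suc m" "2::nat"] by simp
  have "(\<Sum>i=1..2 * Suc m. c ^ multiplicity 2 i)
      = (\<Sum>i=1..2*m. c ^ multiplicity 2 i) + 1 + c * c ^ multiplicity 2 (Suc m)"
    by (simp add: odd even)
  also have "\<dots> = real (Suc m) + c * (\<Sum>i=1..Suc m. c ^ multiplicity 2 i)"
    unfolding Suc.IH by (simp add: algebra_simps)
  finally show ?case .
qed simp

text \<open>The function \<open>i \<mapsto> multiplicity 2 i\<close> takes the value \<open>v\<close> with frequency
  \<open>2 ^ - (v + 1)\<close>, so a weight that grows like \<open>c ^ v\<close> has bounded averages as long as \<open>c < 2\<close>. The base
  \<open>3/2\<close> is one convenient choice; by the doubling identity a bound \<open>C * n\<close> propagates from \<open>m\<close> to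
  \<open>2 * m\<close> as soon as \<open>1 + 3/2 * C \<le> 2 * C\<close>, that is, \<open>C \<ge> 2\<close>.\<close>

lemma ruler_power_sum_le: "(\<Sum>i=1..n. (3/2::real) ^ multiplicity 2 (i::nat)) \<le> 2 * real n"
proof (induction n rule: less_induct)
  case (less n)
  define m where "m = n div 2"
  let ?F = "\<lambda>n. \<Sum>i=1..n. (3/2::real) ^ multiplicity 2 (i::nat)"
  show ?case
  proof (cases "n = 0")
    case False
    then have "?F m \<le> 2 * real m"
      using less.IH[of m] by (simp add: m_def)
    then have D: "?F (2*m) \<le> 4 * real m"
      using ruler_power_sum_double[of "3/2" m] by simp
    show ?thesis
    proof (cases "even n")
      case True
      then have "n = 2 * m" by (simp add: m_def)
      then show ?thesis using D by simp
    next
      case False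
      then have n: "n = Suc (2 * m)" by (simp add: m_def)
      have "multiplicity 2 n = 0"
        by (rule not_dvd_imp_multiplicity_0) (use False in simp)
      then show ?thesis using D n by simp
    qed
  qed simp
qed

text \<open>Countably many sets of reals, each visited with at most linear growth, that keep away from
  each other by prescribed distances \<open>N k + N l\<close>, however fast \<open>N\<close> grows. To each \<open>k\<close> a \<open>2\<close>-adic valuation
  \<open>e k\<close> is reserved, so large that \<open>N k \<le> (3/2) ^ e k\<close>. Every index \<open>i \<ge> 1\<close> of valuation \<open>e k\<close> is then
  given a zone of radius \<open>N k\<close>, every other index a zone of radius \<open>0\<close>, and the zones are laid out
  one after the other on the half-line. The \<open>i\<close>-th centre is \<open>O(i)\<close> because the
  radii have bounded averages, and the indices of valuation \<open>e k\<close> form an arithmetic progression, so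
  the centres belonging to \<open>k\<close> have positive lower density.\<close>

lemma separated_sequences_exist:
  fixes N :: "nat \<Rightarrow> real"
  assumes N: "\<And>k. 0 \<le> N k"
  obtains P :: "nat \<Rightarrow> nat \<Rightarrow> real" where
    "\<And>k j. N k \<le> P k j" "\<And>k j. real j \<le> P k j"
    "\<And>k j l i. (k, j) \<noteq> (l, i) \<Longrightarrow> N k + N l \<le> \<bar>P k j - P l i\<bar>"
    "\<And>k. \<exists>H>0. \<forall>j. P k j \<le> H * (real j + 1)"
proof -
  have "\<exists>m. N k \<le> (3/2) ^ m" for k
    using real_arch_pow[of "3/2" "N k"] by (auto intro: less_imp_le)
  then obtain m where m: "\<And>k. N k \<le> (3/2) ^ m k" by metis
  \<comment> \<open>The pairing makes \<open>e\<close> injective and only increases the exponent \<open>m k\<close>.\<close>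
  define e where "e k = prod_encode (k, m k)" for k
  have "inj e" by (rule injI) (simp add: e_def)
  have Ne: "N k \<le> (3/2) ^ e k" for k
  proof -
    have "(3/2::real) ^ m k \<le> (3/2) ^ e k"
      by (rule power_increasing) (simp_all add: e_def le_prod_encode_2)
    then show ?thesis using m[of k] by linarith
  qed
  define w where "w v = (if v \<in> range e then N (inv e v) else 0)" for v
  have w_e: "w (e k) = N k" for k by (simp add: w_def inv_f_f[OF \<open>inj e\<close>])
  have w0: "0 \<le> w v" for v by (simp add: w_def N)
  have w_le: "w v \<le> (3/2) ^ v" for v
  proof (cases "v \<in> range e")
    case True
    then show ?thesis using w_e Ne by auto
  qed (simp add: w_def)
  define u where "u i = w (multiplicity 2 (i::nat))" for i
  have u0: "0 \<le> u i" for i by (simp add: u_def w0)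
  \<comment> \<open>The centre of the \<open>n\<close>-th zone: all earlier zones contribute their diameter \<open>2 * u i\<close>, the \<open>n\<close>-th its radius; the summand \<open>n\<close> keeps the centres from accumulating.\<close>
  define p where "p n = real n + (\<Sum>i=1..<n. u i) + (\<Sum>i=1..n. u i)" for n
  have gap: "u a + u b \<le> p b - p a" if "1 \<le> a" "a < b" for a b
  proof -
    have "(\<Sum>i=1..a. u i) \<le> (\<Sum>i=1..<b. u i)"
      by (rule sum_mono2) (use that u0 in auto)
    moreover have "(\<Sum>i=1..a. u i) = (\<Sum>i=1..<a. u i) + u a"
                  "(\<Sum>i=1..b. u i) = (\<Sum>i=1..<b. u i) + u b"
      using that by (cases a; cases b; simp add: atLeastLessThanSuc_atLeastAtMost)+
    ultimately show ?thesis
      using that by (simp add: p_def)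
  qed
  have u_sum: "(\<Sum>i=1..n. u i) \<le> 2 * real n" for n
  proof -
    have "(\<Sum>i=1..n. u i) \<le> (\<Sum>i=1..n. (3/2) ^ multiplicity 2 i)"
      by (rule sum_mono) (simp add: u_def w_le)
    then show ?thesis using ruler_power_sum_le[of n] by linarith
  qed
  have p_le: "p n \<le> 5 * real n" for n
  proof -
    have "(\<Sum>i=1..<n. u i) \<le> (\<Sum>i=1..n. u i)"
      by (rule sum_mono2) (use u0 in auto)
    then show ?thesis using u_sum[of n] by (simp add: p_def)
  qed
  have p_ge: "real n \<le> p n" for n
    by (simp add: p_def sum_nonneg u0)
  define \<iota> where "\<iota> k j = 2 ^ e k * (2 * j + 1)" for k j :: nat
  have mult: "multiplicity 2 (\<iota> k j) = e k" for k j
  proof (rule multiplicity_eqI)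
    show "2 ^ e k dvd \<iota> k j" by (simp add: \<iota>_def)
    have "\<not> 2 ^ e k * 2 dvd 2 ^ e k * (2 * j + 1)"
      by (subst dvd_times_left_cancel_iff) simp_all
    then show "\<not> 2 ^ Suc (e k) dvd \<iota> k j" by (simp add: \<iota>_def mult.commute)
  qed
  have u_\<iota>: "u (\<iota> k j) = N k" for k j
    by (simp add: u_def mult w_e)
  have \<iota>1: "1 \<le> \<iota> k j" for k j by (simp add: \<iota>_def Suc_le_eq)
  have \<iota>_inj: "\<iota> k j \<noteq> \<iota> l i" if "(k, j) \<noteq> (l, i)" for k j l i
  proof
    assume eq: "\<iota> k j = \<iota> l i"
    then have "k = l" using mult \<open>inj e\<close> by (metis injD)
    with eq that show False by (simp add: \<iota>_def)
  qed
  show ?thesis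
  proof (rule that[of "\<lambda>k j. p (\<iota> k j)"])
    fix k j
    have "u (\<iota> k j) \<le> (\<Sum>i=1..\<iota> k j. u i)"
      by (rule member_le_sum) (use \<iota>1 u0 in auto)
    then show "N k \<le> p (\<iota> k j)"
      unfolding u_\<iota> p_def by (simp add: sum_nonneg u0 add_increasing)
    have "j \<le> 1 * (2 * j + 1)" by simp
    also have "\<dots> \<le> \<iota> k j" unfolding \<iota>_def by (rule mult_right_mono) auto
    finally have "real j \<le> real (\<iota> k j)" by simp
    then show "real j \<le> p (\<iota> k j)" using p_ge[of "\<iota> k j"] by linarith
  next
    fix k j l i :: nat
    assume "(k, j) \<noteq> (l, i)"
    then have "\<iota> k j < \<iota> l i \<or> \<iota> l i < \<iota> k j" using \<iota>_inj by (meson nat_neq_iff)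
    then show "N k + N l \<le> \<bar>p (\<iota> k j) - p (\<iota> l i)\<bar>"
      using gap[of "\<iota> k j" "\<iota> l i"] gap[of "\<iota> l i" "\<iota> k j"] \<iota>1 by (auto simp: u_\<iota>)
  next
    fix k
    have "p (\<iota> k j) \<le> (10 * 2 ^ e k) * (real j + 1)" for j
    proof -
      have "p (\<iota> k j) \<le> 5 * real (\<iota> k j)" by (rule p_le)
      also have "\<dots> = (5 * 2 ^ e k) * (2 * real j + 1)" by (simp add: \<iota>_def algebra_simps)
      also have "\<dots> \<le> (5 * 2 ^ e k) * (2 * (real j + 1))" by (rule mult_left_mono) auto
      finally show ?thesis by (simp add: algebra_simps)
    qed
    then show "\<exists>H>0. \<forall>j. p (\<iota> k j) \<le> H * (real j + 1)"
      by (intro exI[of _ "10 * 2 ^ e k"]) simp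
  qed
qed

text \<open>The planar version, inside the cone \<open>0 \<le> Im z \<le> c * Re z\<close>. Over each point of the one-dimensional
  set with label \<open>k\<close> a vertical column of points with spacing \<open>2 * N k\<close> is erected. Points in different columns are
  separated by their real parts, points of one column by their imaginary parts. The height of the
  column grows linearly with its abscissa, so the number of points up to radius \<open>R\<close> is at
  least of order \<open>R\<^sup>2\<close>.\<close>

lemma separated_planar_sets_exist:
  fixes c :: real and N :: "nat \<Rightarrow> real"
  assumes c: "0 < c" "c \<le> 1" and N: "\<And>k. 0 < N k"
  obtains A :: "nat \<Rightarrow> complex set" where
    "\<And>k z. z \<in> A k \<Longrightarrow> 0 \<le> Im z \<and> Im z \<le> c * Re z \<and> N k \<le> Re z"
    "\<And>k l z w. z \<in> A k \<Longrightarrow> w \<in> A l \<Longrightarrow> (k, z) \<noteq> (l, w) \<Longrightarrow> N k + N l \<le> cmod (z - w)"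
    "\<And>k R. finite {z \<in> A k. cmod z \<le> R}"
    "\<And>k. \<exists>d>0. \<forall>\<^sub>F R in at_top. d * R\<^sup>2 \<le> real (card {z \<in> A k. cmod z \<le> R})"
proof -
  obtain P where P: "\<And>k j. N k \<le> P k j" "\<And>k j. real j \<le> P k j"
    "\<And>k j l i. (k, j) \<noteq> (l, i) \<Longrightarrow> N k + N l \<le> \<bar>P k j - P l i\<bar>"
    "\<And>k. \<exists>H>0. \<forall>j. P k j \<le> H * (real j + 1)"
    using separated_sequences_exist[of N] N less_imp_le by metis
  have "\<exists>b::nat. 2 * N k / c \<le> real b" for k by (rule real_arch_simple)
  then obtain b where b: "\<And>k. 2 * N k / c \<le> real (b k)" by metis
  have bN: "2 * N k \<le> c * real (b k)" for k
    using b[of k] c by (simp add: field_simps)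
  have b1: "1 \<le> b k" for k
  proof (rule ccontr)
    assume "\<not> 1 \<le> b k"
    then have "b k = 0" by simp
    then show False using bN[of k] N[of k] by simp
  qed
  define z where "z k j q = Complex (P k j) (2 * N k * real q)" for k j q
  \<comment> \<open>The factor \<open>b k\<close> makes the condition \<open>b k * q \<le> j\<close> imply that the height stays below \<open>c * P k j\<close>, as \<open>j \<le> P k j\<close>.\<close>
  define A where "A k = {z k j q | j q. b k * q \<le> j}" for k
  have sep: "N k + N l \<le> cmod (z k j q - z l i r)" if "(k, j, q) \<noteq> (l, i, r)" for k j q l i r
  proof (cases "(k, j) = (l, i)")
    case False
    then have "N k + N l \<le> \<bar>Re (z k j q - z l i r)\<bar>"
      using P(3) by (simp add: z_def)
    then show ?thesis using abs_Re_le_cmod order_trans by blast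
  next
    case True
    with that have "q \<noteq> r" by auto
    then have "1 \<le> \<bar>real q - real r\<bar>" by linarith
    then have "2 * N k * 1 \<le> 2 * N k * \<bar>real q - real r\<bar>"
      by (intro mult_left_mono) (use N[of k] in auto)
    also have "\<dots> = \<bar>Im (z k j q - z l i r)\<bar>"
      using True N[of k] by (simp add: z_def abs_mult flip: right_diff_distrib)
    also have "\<dots> \<le> cmod (z k j q - z l i r)" by (rule abs_Im_le_cmod)
    finally show ?thesis using True by simp
  qed
  have inj: "(j, q) = (i, r)" if "z k j q = z k i r" for k j q i r
    using sep[of k j q k i r] N[of k] that by fastforce
  have Im_le: "2 * N k * real q \<le> c * real j" if "b k * q \<le> j" for k q j
  proof -
    have "2 * N k * real q \<le> c * real (b k) * real q"
      by (rule mult_right_mono) (use bN in auto)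
    also have "\<dots> = c * real (b k * q)" by simp
    also have "\<dots> \<le> c * real j" by (rule mult_left_mono) (use that c in \<open>simp_all only: of_nat_le_iff\<close>)
    finally show ?thesis .
  qed
  have Im_le_P: "2 * N k * real q \<le> c * P k j" if "b k * q \<le> j" for k q j
    using Im_le[OF that] mult_left_mono[OF P(2)[of j k], of c] c by linarith
  have fin: "finite {y \<in> A k. cmod y \<le> R}" for k and R :: real
  proof -
    have "{y \<in> A k. cmod y \<le> R} \<subseteq> (\<lambda>(j, q). z k j q) ` ({..nat \<lfloor>R\<rfloor>} \<times> {..nat \<lfloor>R\<rfloor>})"
    proof
      fix y assume "y \<in> {y \<in> A k. cmod y \<le> R}"
      then obtain j q where y: "y = z k j q" "b k * q \<le> j" "cmod y \<le> R" by (auto simp: A_def)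
      have "real j \<le> P k j" by (rule P)
      also have "\<dots> \<le> cmod y" using abs_Re_le_cmod[of y] by (simp add: y z_def)
      finally have "j \<le> nat \<lfloor>R\<rfloor>" using y by (simp add: le_nat_floor)
      moreover have "q \<le> j" using y(2) mult_le_mono1[OF b1[of k], of q] by linarith
      ultimately show "y \<in> (\<lambda>(j, q). z k j q) ` ({..nat \<lfloor>R\<rfloor>} \<times> {..nat \<lfloor>R\<rfloor>})"
        using y(1) by force
    qed
    then show ?thesis by (rule finite_subset) auto
  qed
  show ?thesis
  proof (rule that[of A])
    fix k y assume "y \<in> A k"
    then show "0 \<le> Im y \<and> Im y \<le> c * Re y \<and> N k \<le> Re y"
      using Im_le_P P(1) N by (auto simp: A_def z_def less_imp_le)
  next
    fix k l y x assume "y \<in> A k" "x \<in> A l" and ne: "(k, y) \<noteq> (l, x)"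
    then obtain j q i r where "y = z k j q" "x = z l i r" by (auto simp: A_def)
    with ne show "N k + N l \<le> cmod (y - x)"
      using sep[of k j q l i r] by fastforce
  next
    show "finite {y \<in> A k. cmod y \<le> R}" for k R by (rule fin)
  next
    fix k
    obtain H where H: "H > 0" "\<And>j. P k j \<le> H * (real j + 1)" using P(4) by blast
    let ?b = "b k"
    \<comment> \<open>The points with \<open>b k * M \<le> j < b k * M + M\<close> and \<open>q < M\<close> already give \<open>M\<^sup>2\<close> of them.\<close>
    have count: "real M ^ 2 \<le> card {y \<in> A k. cmod y \<le> 4 * H * real (?b * M)}" for M
    proof -
      have "(\<lambda>(j, q). z k j q) ` ({?b * M..<?b * M + M} \<times> {..<M})
              \<subseteq> {y \<in> A k. cmod y \<le> 4 * H * real (?b * M)}" (is "_ ` ?I \<subseteq> ?Y")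
      proof clarsimp
        fix j q assume j: "?b * M \<le> j" "j < ?b * M + M" and q: "q < M"
        have bq: "?b * q \<le> j" using q j(1) by (meson le_trans less_imp_le_nat mult_le_mono2)
        have "j + 1 \<le> ?b * M + ?b * M"
          using j(2) b1[of k] mult_le_mono1[of 1 ?b M] by linarith
        then have "real (j + 1) \<le> real (?b * M + ?b * M)" by (rule of_nat_mono)
        then have j2: "real j + 1 \<le> 2 * real (?b * M)" by (simp add: algebra_simps)
        have "cmod (z k j q) \<le> \<bar>P k j\<bar> + \<bar>2 * N k * real q\<bar>"
          using cmod_le[of "z k j q"] by (simp add: z_def)
        also have "\<dots> \<le> 2 * P k j"
        proof -
          have "c * P k j \<le> 1 * P k j"
            by (rule mult_right_mono) (use c N[of k] P(1)[of k j] in auto)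
          moreover have "0 \<le> 2 * N k * real q" using N[of k] by simp
          ultimately show ?thesis using Im_le_P[OF bq] N[of k] P(1)[of k j] by linarith
        qed
        also have "\<dots> \<le> 2 * (H * (real j + 1))" using H(2) by simp
        also have "\<dots> \<le> 2 * (H * (2 * real (?b * M)))"
          using j2 H(1) by (intro mult_left_mono) auto
        finally show "z k j q \<in> A k \<and> cmod (z k j q) \<le> 4 * H * (real ?b * real M)"
          using bq by (auto simp: A_def)
      qed
      then have "card ((\<lambda>(j, q). z k j q) ` ?I) \<le> card ?Y" by (rule card_mono[OF fin])
      moreover have "inj_on (\<lambda>(j, q). z k j q) ({?b * M..<?b * M + M} \<times> {..<M})"
        by (rule inj_onI) (use inj in auto)
      ultimately have "M\<^sup>2 \<le> card ?Y"
        by (simp add: card_image power2_eq_square)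
      then show ?thesis by (metis of_nat_le_iff of_nat_power)
    qed
    define L where "L = 4 * H * real ?b"
    have L: "L > 0" using H(1) b1[of k] by (simp add: L_def)
    have "1 / (4 * L\<^sup>2) * R\<^sup>2 \<le> real (card {y \<in> A k. cmod y \<le> R})" if R: "R \<ge> 2 * L" for R
    proof -
      define M where "M = nat \<lfloor>R / L\<rfloor>"
      have RL: "2 \<le> R / L" using R L by (simp add: field_simps)
      have M: "real M \<le> R / L" "R / L - 1 < real M"
        unfolding M_def using RL by linarith+
      have "R / (2 * L) \<le> real M" using M RL by (simp add: field_simps)
      then have "(R / (2 * L))\<^sup>2 \<le> real M ^ 2"
        by (rule power_mono) (use R L in simp)
      also have "\<dots> \<le> card {y \<in> A k. cmod y \<le> 4 * H * real (?b * M)}"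
        by (rule count)
      also have "\<dots> \<le> card {y \<in> A k. cmod y \<le> R}"
      proof -
        have "4 * H * real (?b * M) = L * real M" by (simp add: L_def)
        also have "\<dots> \<le> R" using M(1) L by (simp add: field_simps)
        finally have "{y \<in> A k. cmod y \<le> 4 * H * real (?b * M)} \<subseteq> {y \<in> A k. cmod y \<le> R}" by auto
        then show ?thesis using fin card_mono of_nat_mono by blast
      qed
      finally show ?thesis by (simp add: power2_eq_square field_simps)
    qed
    then show "\<exists>d>0. \<forall>\<^sub>F R in at_top. d * R\<^sup>2 \<le> real (card {y \<in> A k. cmod y \<le> R})"
      using L by (intro exI[of _ "1 / (4 * L\<^sup>2)"]) (auto simp: eventually_at_top_linorder)
  qed
qed

section \<open>The sector and its lower density\<close>

text \<open>The sector is an intersection of two half-planes, because for \<open>\<bar>\<theta>\<bar> \<le> pi\<close> the sign of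
  \<open>sin (\<bar>\<theta>\<bar> - \<alpha>)\<close> decides whether \<open>\<bar>\<theta>\<bar> \<le> \<alpha>\<close>. Closedness and stability under addition can be read off
  from this form.\<close>

lemma sector_eq_halfplanes:
  assumes "0 < \<alpha>" "\<alpha> \<le> pi / 2"
  shows "sector \<alpha> = {z. \<bar>Im z\<bar> * cos \<alpha> \<le> Re z * sin \<alpha>}"
proof (intro equalityI subsetI)
  fix z assume "z \<in> sector \<alpha>"
  then obtain r \<theta> where z: "z = complex_of_real r * cis \<theta>" "0 \<le> r" "\<bar>\<theta>\<bar> \<le> \<alpha>"
    by (auto simp: sector_def)
  have "0 \<le> sin (\<alpha> - \<bar>\<theta>\<bar>)"
    by (rule sin_ge_zero) (use z assms in auto)
  then have "\<bar>sin \<theta>\<bar> * cos \<alpha> \<le> cos \<theta> * sin \<alpha>"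
    using sin_ge_zero[of "\<bar>\<theta>\<bar>"] z assms
    by (cases "0 \<le> \<theta>") (auto simp: sin_diff sin_add algebra_simps)
  then have "r * (\<bar>sin \<theta>\<bar> * cos \<alpha>) \<le> r * (cos \<theta> * sin \<alpha>)"
    by (rule mult_left_mono) (rule z)
  then show "z \<in> {z. \<bar>Im z\<bar> * cos \<alpha> \<le> Re z * sin \<alpha>}"
    using z(2) by (simp add: z(1) abs_mult algebra_simps)
next
  fix z assume z: "z \<in> {z. \<bar>Im z\<bar> * cos \<alpha> \<le> Re z * sin \<alpha>}"
  show "z \<in> sector \<alpha>"
  proof (cases "z = 0")
    case True
    then show ?thesis using assms by (auto simp: sector_def intro!: exI[of _ 0])
  next
    case False
    define \<theta> where "\<theta> = Arg z"
    have z_eq: "z = complex_of_real (cmod z) * cis \<theta>"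
      using Arg_eq[OF False] by (simp add: \<theta>_def cis_conv_exp)
    have \<theta>: "-pi < \<theta>" "\<theta> \<le> pi" by (simp_all add: \<theta>_def mpi_less_Arg Arg_le_pi)
    have "\<bar>Im z\<bar> = cmod z * \<bar>sin \<theta>\<bar>" "Re z = cmod z * cos \<theta>"
      by (subst z_eq; simp add: abs_mult)+
    then have "cmod z * (\<bar>sin \<theta>\<bar> * cos \<alpha>) \<le> cmod z * (cos \<theta> * sin \<alpha>)"
      using z by (simp add: algebra_simps)
    then have "\<bar>sin \<theta>\<bar> * cos \<alpha> \<le> cos \<theta> * sin \<alpha>"
      using False by simp
    moreover have "\<bar>sin \<theta>\<bar> = sin \<bar>\<theta>\<bar>"
      using sin_ge_zero[of "\<bar>\<theta>\<bar>"] \<theta> by (cases "0 \<le> \<theta>") auto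
    ultimately have "sin (\<bar>\<theta>\<bar> - \<alpha>) \<le> 0"
      by (simp add: sin_diff algebra_simps)
    then have "\<bar>\<theta>\<bar> \<le> \<alpha>"
      using sin_gt_zero[of "\<bar>\<theta>\<bar> - \<alpha>"] \<theta> assms by linarith
    then show ?thesis using z_eq norm_ge_zero[of z] unfolding sector_def by blast
  qed
qed

context
  fixes \<alpha> :: real
  assumes \<alpha>: "0 < \<alpha>" "\<alpha> \<le> pi / 2"
begin

lemma sector_sin_pos: "0 < sin \<alpha>" and sector_cos_nonneg: "0 \<le> cos \<alpha>"
  using \<alpha> by (auto intro: sin_gt_zero cos_ge_zero)

lemma closed_sector: "closed (sector \<alpha>)"
  unfolding sector_eq_halfplanes[OF \<alpha>]
  by (intro closed_Collect_le continuous_intros)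

lemma sector_add:
  assumes "z \<in> sector \<alpha>" "w \<in> sector \<alpha>"
  shows "z + w \<in> sector \<alpha>"
proof -
  have "\<bar>Im z + Im w\<bar> * cos \<alpha> \<le> (\<bar>Im z\<bar> + \<bar>Im w\<bar>) * cos \<alpha>"
    by (rule mult_right_mono) (use sector_cos_nonneg in auto)
  then show ?thesis
    using assms by (simp add: sector_eq_halfplanes[OF \<alpha>] algebra_simps)
qed

lemma in_sectorI:
  assumes "\<bar>Im z\<bar> \<le> sin \<alpha> * Re z"
  shows "z \<in> sector \<alpha>"
proof -
  have "\<bar>Im z\<bar> * cos \<alpha> \<le> \<bar>Im z\<bar> * 1" by (rule mult_left_mono) auto
  then show ?thesis using assms by (simp add: sector_eq_halfplanes[OF \<alpha>] mult.commute)
qed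

lemma zero_in_sector: "0 \<in> sector \<alpha>"
  by (rule in_sectorI) simp

text \<open>The sector has interior points of every small modulus; small discs are enough for the measure
  estimate below and have an explicit area.\<close>

lemma cball_subset_sector:
  assumes "0 < \<delta>"
  shows "cball (complex_of_real (\<delta>/2)) (\<delta>/4 * sin \<alpha>) \<subseteq> sector \<alpha> \<inter> cball 0 \<delta>"
proof
  fix z assume "z \<in> cball (complex_of_real (\<delta>/2)) (\<delta>/4 * sin \<alpha>)"
  then have d: "cmod (z - complex_of_real (\<delta>/2)) \<le> \<delta>/4 * sin \<alpha>"
    by (simp add: dist_norm norm_minus_commute)
  have "\<bar>Im z\<bar> \<le> \<delta>/4 * sin \<alpha>"
    using abs_Im_le_cmod[of "z - complex_of_real (\<delta>/2)"] d by simp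
  have s: "\<delta>/4 * sin \<alpha> \<le> \<delta>/4 * 1" by (rule mult_left_mono) (use assms in auto)
  have "\<delta>/4 \<le> Re z"
    using abs_Re_le_cmod[of "z - complex_of_real (\<delta>/2)"] d s by simp
  then have "sin \<alpha> * (\<delta>/4) \<le> sin \<alpha> * Re z"
    by (rule mult_left_mono) (use sector_sin_pos in simp)
  then have "z \<in> sector \<alpha>"
    using \<open>\<bar>Im z\<bar> \<le> _\<close> by (intro in_sectorI) (simp add: mult.commute)
  moreover have "cmod z \<le> \<delta>"
  proof -
    have "cmod (complex_of_real (\<delta>/2)) = \<delta>/2" using assms by simp
    then show ?thesis
      using norm_triangle_sub[of z "complex_of_real (\<delta>/2)"] d s assms by linarith
  qed
  ultimately show "z \<in> sector \<alpha> \<inter> cball 0 \<delta>" by simp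
qed

text \<open>Passing from points to area: around the at least \<open>d * (R - 1)\<^sup>2\<close> points \<open>z\<close> of \<open>A\<close> with modulus at
  most \<open>R - 1\<close> there are pairwise disjoint discs of one fixed area, all contained in \<open>B\<close> and in the disc
  of radius \<open>R\<close>, whose own area is of order \<open>R\<^sup>2\<close>.\<close>

lemma lower_density_pos_of_separated_translates:
  assumes B: "B \<in> sets lebesgue"
    and A: "A \<subseteq> sector \<alpha>"
    and fin: "\<And>R. finite {z \<in> A. cmod z \<le> R}"
    and sep: "\<And>z w. z \<in> A \<Longrightarrow> w \<in> A \<Longrightarrow> z \<noteq> w \<Longrightarrow> 1 \<le> cmod (z - w)"
    and d: "d > 0" "\<forall>\<^sub>F R in at_top. d * R\<^sup>2 \<le> real (card {z \<in> A. cmod z \<le> R})"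
    and \<delta>: "0 < \<delta>" "\<delta> \<le> 1"
    and sub: "\<And>z s. z \<in> A \<Longrightarrow> s \<in> sector \<alpha> \<Longrightarrow> cmod s \<le> \<delta> \<Longrightarrow> z + s \<in> B"
  shows "lower_density (sector \<alpha>) B > 0"
proof -
  define a where "a = complex_of_real (\<delta>/2)"
  define \<rho> where "\<rho> = \<delta>/4 * sin \<alpha>"
  define v where "v = measure lborel (cball a \<rho>)"
  define V where "V = measure lborel (cball (0::complex) 1)"
  have \<rho>: "0 < \<rho>" using \<delta> sector_sin_pos by (simp add: \<rho>_def)
  have \<rho>4: "\<rho> \<le> 1 / 4"
    using mult_mono[of \<delta> 1 "sin \<alpha>" 1] \<delta> sector_sin_pos by (simp add: \<rho>_def)
  have v: "v > 0" unfolding v_def by (rule content_cball_pos[OF \<rho>])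
  have V: "V > 0" unfolding V_def by (rule content_cball_pos) simp
  have v_translate: "measure lebesgue (cball (z + a) \<rho>) = v" for z
    using content_ball_conv_unit_ball[of \<rho> "z + a"] content_ball_conv_unit_ball[of \<rho> a] \<rho>
    by (simp add: v_def content_cball_conv_ball)
  have V_scale: "measure lebesgue (cball (0::complex) R) = V * R\<^sup>2" if "R \<ge> 0" for R
    using content_ball_conv_unit_ball[OF that, of "0::complex"]
    by (simp add: V_def content_cball_conv_ball)
  \<comment> \<open>Radius \<open>R - 1\<close>, since the translated discs reach at most \<open>\<delta> \<le> 1\<close> beyond the points.\<close>
  have num_ge: "real (card {z \<in> A. cmod z \<le> R - 1}) * v
        \<le> measure lebesgue (B \<inter> {s \<in> sector \<alpha>. cmod s \<le> R})" for R
  proof -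
    let ?F = "{z \<in> A. cmod z \<le> R - 1}"
    let ?D = "{s \<in> sector \<alpha>. cmod s \<le> R}"
    have D: "?D = sector \<alpha> \<inter> cball 0 R" by auto
    have "compact ?D" unfolding D by (intro closed_Int_compact closed_sector compact_cball)
    then have "?D \<in> lmeasurable" by (rule lmeasurable_compact)
    then have "?D \<inter> B \<in> lmeasurable" using B by (rule fmeasurable_Int_fmeasurable)
    then have BD: "B \<inter> ?D \<in> lmeasurable" by (simp only: Int_commute)
    have "pairwise (\<lambda>z w. disjnt (cball (z + a) \<rho>) (cball (w + a) \<rho>)) ?F"
    proof (rule pairwiseI)
      fix z w assume "z \<in> ?F" "w \<in> ?F" "z \<noteq> w"
      then have "1 \<le> dist (z + a) (w + a)" using sep by (simp add: dist_norm)
      then show "disjnt (cball (z + a) \<rho>) (cball (w + a) \<rho>)"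
        using \<rho>4 disjoint_cballI[of \<rho> \<rho> "z + a" "w + a"] by (simp add: disjnt_def)
    qed
    then have "measure lebesgue (\<Union>z\<in>?F. cball (z + a) \<rho>) = (\<Sum>z\<in>?F. measure lebesgue (cball (z + a) \<rho>))"
      by (intro measure_UNION' fin lmeasurable_cball)
    also have "\<dots> = real (card ?F) * v" by (simp add: v_translate)
    finally have eq: "measure lebesgue (\<Union>z\<in>?F. cball (z + a) \<rho>) = real (card ?F) * v" .
    have "(\<Union>z\<in>?F. cball (z + a) \<rho>) \<subseteq> B \<inter> ?D"
    proof
      fix y assume "y \<in> (\<Union>z\<in>?F. cball (z + a) \<rho>)"
      then obtain z where z: "z \<in> A" "cmod z \<le> R - 1" and y: "y \<in> cball (z + a) \<rho>" by auto
      have "y - z \<in> cball a \<rho>" using y by (simp add: dist_norm algebra_simps)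
      then have s: "y - z \<in> sector \<alpha>" "cmod (y - z) \<le> \<delta>"
        using cball_subset_sector[OF \<delta>(1)] by (auto simp: a_def \<rho>_def)
      have "y \<in> B" using sub[OF z(1) s] by simp
      moreover have "y \<in> sector \<alpha>" using sector_add[of z "y - z"] A z s by auto
      moreover have "cmod y \<le> R" using norm_triangle_sub[of y z] z s \<delta> by simp
      ultimately show "y \<in> B \<inter> ?D" by simp
    qed
    then show ?thesis
      unfolding eq[symmetric] using BD fin
      by (intro measure_mono_fmeasurable) auto
  qed
  \<comment> \<open>The factor \<open>4\<close> comes from \<open>R / 2 \<le> R - 1\<close>.\<close>
  define \<eta> where "\<eta> = d * v / (4 * V)"
  have \<eta>: "\<eta> > 0" using d v V by (simp add: \<eta>_def)
  have "\<forall>\<^sub>F R in at_top. d * (R - 1)\<^sup>2 \<le> real (card {z \<in> A. cmod z \<le> R - 1})"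
  proof -
    have "filterlim (\<lambda>R::real. R - 1) at_top at_top"
      using filterlim_tendsto_add_at_top[OF tendsto_const filterlim_ident, of "-1::real"]
      by (simp add: add.commute)
    then show ?thesis by (rule eventually_compose_filterlim[OF d(2)])
  qed
  then have "\<forall>\<^sub>F R in at_top. ereal \<eta> \<le> ereal
      (measure lebesgue (B \<inter> {s \<in> sector \<alpha>. cmod s \<le> R}) / measure lebesgue {s \<in> sector \<alpha>. cmod s \<le> R})"
    using eventually_ge_at_top[of 2]
  proof eventually_elim
    case (elim R)
    let ?D = "{s \<in> sector \<alpha>. cmod s \<le> R}"
    have D: "?D = sector \<alpha> \<inter> cball 0 R" by auto
    have "compact ?D" unfolding D by (intro closed_Int_compact closed_sector compact_cball)
    then have Dm: "?D \<in> lmeasurable" by (rule lmeasurable_compact)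
    have D_le: "measure lebesgue ?D \<le> V * R\<^sup>2"
    proof -
      have "measure lebesgue ?D \<le> measure lebesgue (cball (0::complex) R)"
        using Dm by (intro measure_mono_fmeasurable) auto
      then show ?thesis using V_scale[of R] elim(2) by simp
    qed
    have BD_le: "measure lebesgue (B \<inter> ?D) \<le> measure lebesgue ?D"
      using B Dm by (intro measure_mono_fmeasurable) auto
    have "R / 2 \<le> R - 1" using elim(2) by simp
    then have "(R / 2)\<^sup>2 \<le> (R - 1)\<^sup>2" using elim(2) by (intro power_mono) auto
    then have "d * (R / 2)\<^sup>2 * v \<le> d * (R - 1)\<^sup>2 * v"
      using d v by (intro mult_right_mono mult_left_mono) auto
    also have "\<dots> \<le> real (card {z \<in> A. cmod z \<le> R - 1}) * v"
      using elim(1) v by (intro mult_right_mono) auto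
    also have "\<dots> \<le> measure lebesgue (B \<inter> ?D)" by (rule num_ge)
    finally have num: "d * (R / 2)\<^sup>2 * v \<le> measure lebesgue (B \<inter> ?D)" .
    have "0 < d * (R / 2)\<^sup>2 * v" using d v elim(2) by simp
    then have D0: "0 < measure lebesgue ?D" using num BD_le by linarith
    have "\<eta> * measure lebesgue ?D \<le> \<eta> * (V * R\<^sup>2)"
      using D_le \<eta> by (intro mult_left_mono) auto
    also have "\<dots> = d * (R / 2)\<^sup>2 * v" using V by (simp add: \<eta>_def power_divide)
    also have "\<dots> \<le> measure lebesgue (B \<inter> ?D)" by (rule num)
    finally show ?case using D0 by (simp add: pos_le_divide_eq)
  qed
  then have "ereal \<eta> \<le> lower_density (sector \<alpha>) B"
    unfolding lower_density_def by (rule Liminf_bounded)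
  then show ?thesis using \<eta> by (metis ereal_less(2) less_le_trans)
qed

end

section \<open>Sums and operators in Banach spaces\<close>

text \<open>By Baire's theorem one of the closed sets on which all \<open>T s\<close> are bounded by \<open>n\<close> contains
  a ball, and linearity carries a bound on this ball to the ball of the same radius around \<open>0\<close>.\<close>

lemma uniform_boundedness_principle:
  fixes T :: "'i \<Rightarrow> 'a::banach \<Rightarrow> 'b::real_normed_vector"
  assumes lin: "\<And>s. s \<in> K \<Longrightarrow> bounded_linear (T s)"
    and ptw: "\<And>y. \<exists>C. \<forall>s\<in>K. norm (T s y) \<le> C"
  obtains M where "M > 0" "\<And>s y. s \<in> K \<Longrightarrow> norm (T s y) \<le> M * norm y"
proof -
  define E where "E n = (\<Inter>s\<in>K. {y. norm (T s y) \<le> real n})" for n :: nat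
  have cl: "closed (E n)" for n
    unfolding E_def
    by (intro closed_INT ballI closed_Collect_le continuous_intros
          linear_continuous_on[OF lin]) auto
  have "(\<Union>n. E n) = UNIV"
  proof -
    have "\<exists>n. y \<in> E n" for y
    proof -
      obtain C where C: "\<forall>s\<in>K. norm (T s y) \<le> C" using ptw by blast
      obtain n where "C \<le> real n" using real_arch_simple by blast
      then have "y \<in> E n" using C order_trans unfolding E_def by blast
      then show ?thesis by blast
    qed
    then show ?thesis by auto
  qed
  moreover have "interior (\<Union>n. E n) = {}" if "\<And>n. interior (E n) = {}"
  proof -
    have "euclidean interior_of \<Union> (range E) = {}"
    proof (rule Baire_category_alt)
      show "completely_metrizable_space (euclidean :: 'a topology) \<or>
          locally_compact_space (euclidean :: 'a topology) \<and> regular_space (euclidean :: 'a topology)"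
        using completely_metrizable_space_euclidean by blast
    qed (use that cl in \<open>auto simp flip: closed_closedin\<close>)
    then show ?thesis by simp
  qed
  ultimately obtain n where "interior (E n) \<noteq> {}" by auto
  then obtain y0 \<rho> where \<rho>: "\<rho> > 0" "cball y0 \<rho> \<subseteq> E n"
    by (metis all_not_in_conv mem_interior_cball)
  show ?thesis
  proof (rule that[of "2 * (real n + 1) / \<rho>"])
    show "0 < 2 * (real n + 1) / \<rho>" using \<rho> by simp
    fix s y assume s: "s \<in> K"
    interpret bounded_linear "T s" by (rule lin[OF s])
    show "norm (T s y) \<le> 2 * (real n + 1) / \<rho> * norm y"
    proof (cases "y = 0")
      case False
      define h where "h = (\<rho> / norm y) *\<^sub>R y"
      have "norm h = \<rho>" using False \<rho> by (simp add: h_def)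
      then have "y0 + h \<in> E n" "y0 \<in> E n" using \<rho> by (auto simp: subset_iff dist_norm)
      then have "norm (T s (y0 + h)) \<le> n" "norm (T s y0) \<le> n" using s by (auto simp: E_def)
      then have "norm (T s (y0 + h) - T s y0) \<le> 2 * n"
        using norm_triangle_ineq4[of "T s (y0 + h)" "T s y0"] by linarith
      then have "norm (T s h) \<le> 2 * n" by (simp add: add)
      moreover have "norm (T s h) = \<rho> / norm y * norm (T s y)"
        using \<rho> by (simp add: h_def scaleR)
      ultimately have "norm (T s y) \<le> 2 * n * norm y / \<rho>"
        using False \<rho> by (simp add: field_simps)
      also have "\<dots> \<le> 2 * (real n + 1) / \<rho> * norm y"
        using \<rho> by (simp add: field_simps)
      finally show ?thesis .
    qed (simp add: zero)
  qed
qed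

text \<open>The sums below converge unconditionally but need not converge absolutely, so summability
  has to come from completeness.\<close>

lemma summable_on_Cauchy_criterion:
  fixes f :: "'i \<Rightarrow> 'b::banach"
  assumes "\<And>\<epsilon>. \<epsilon> > 0 \<Longrightarrow>
    \<exists>F\<^sub>0. finite F\<^sub>0 \<and> F\<^sub>0 \<subseteq> A \<and> (\<forall>F. finite F \<and> F \<subseteq> A - F\<^sub>0 \<longrightarrow> norm (sum f F) < \<epsilon>)"
  shows "f summable_on A"
proof -
  have "\<exists>P. eventually P (finite_subsets_at_top A) \<and>
          (\<forall>F G. P F \<and> P G \<longrightarrow> dist (sum f F) (sum f G) < \<epsilon>)" if "\<epsilon> > 0" for \<epsilon>
  proof -
    obtain F\<^sub>0 where F0: "finite F\<^sub>0" "F\<^sub>0 \<subseteq> A"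
      and small: "\<forall>F. finite F \<and> F \<subseteq> A - F\<^sub>0 \<longrightarrow> norm (sum f F) < \<epsilon> / 2"
      using assms[OF half_gt_zero[OF \<open>\<epsilon> > 0\<close>]] by (elim exE conjE)
    have split: "sum f F = sum f F\<^sub>0 + sum f (F - F\<^sub>0)" if "finite F" "F\<^sub>0 \<subseteq> F" for F
      using that by (metis add.commute sum.subset_diff)
    have "dist (sum f F) (sum f G) < \<epsilon>"
      if "finite F \<and> F\<^sub>0 \<subseteq> F \<and> F \<subseteq> A" "finite G \<and> F\<^sub>0 \<subseteq> G \<and> G \<subseteq> A" for F G
    proof -
      have "norm (sum f (F - F\<^sub>0)) < \<epsilon> / 2" "norm (sum f (G - F\<^sub>0)) < \<epsilon> / 2"
        by (rule small[rule_format]; use that in auto)+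
      then have "norm (sum f (F - F\<^sub>0) - sum f (G - F\<^sub>0)) < \<epsilon>"
        using norm_triangle_ineq4[of "sum f (F - F\<^sub>0)" "sum f (G - F\<^sub>0)"] by linarith
      then show ?thesis using that by (simp add: dist_norm split[of F] split[of G])
    qed
    moreover have "eventually (\<lambda>F. finite F \<and> F\<^sub>0 \<subseteq> F \<and> F \<subseteq> A) (finite_subsets_at_top A)"
      using F0 by (auto simp: eventually_finite_subsets_at_top)
    ultimately show ?thesis
      by (intro exI[of _ "\<lambda>F. finite F \<and> F\<^sub>0 \<subseteq> F \<and> F \<subseteq> A"] conjI allI impI) auto
  qed
  then have "cauchy_filter (filtermap (sum f) (finite_subsets_at_top A))"
    by (simp add: cauchy_filter_metric_filtermap)
  moreover have "complete (UNIV :: 'b set)"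
    by (meson Cauchy_convergent UNIV_I complete_def convergent_def)
  ultimately obtain L where "(sum f \<longlongrightarrow> L) (finite_subsets_at_top A)"
    using complete_uniform[where S = UNIV] by (force simp add: filterlim_def)
  then show ?thesis using summable_on_def has_sum_def by blast
qed

lemma norm_infsum_le_of_finite_sums:
  fixes f :: "'i \<Rightarrow> 'b::real_normed_vector"
  assumes "f summable_on A"
    and "\<And>F. finite F \<Longrightarrow> F \<subseteq> A \<Longrightarrow> norm (sum f F) \<le> C"
  shows "norm (infsum f A) \<le> C"
proof (rule tendsto_upperbound)
  show "((\<lambda>F. norm (sum f F)) \<longlongrightarrow> norm (infsum f A)) (finite_subsets_at_top A)"
    using has_sum_infsum[OF assms(1)] by (intro tendsto_norm) (simp add: has_sum_def)
  show "\<forall>\<^sub>F F in finite_subsets_at_top A. norm (sum f F) \<le> C"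
    using assms(2) by (auto intro: eventually_finite_subsets_at_top_weakI)
qed auto

text \<open>A set that is dense in a separable metric space contains a sequence that returns to every
  ball infinitely often. The recurrence lets the index of an approximating term be chosen as large as the
  error bounds at that index require.\<close>

lemma separable_dense_sequence:
  fixes X\<^sub>0 :: "'a::metric_space set"
  assumes sep: "separable_space (euclidean :: 'a topology)" and dense: "closure X\<^sub>0 = UNIV"
  obtains x :: "nat \<Rightarrow> 'a" where "\<And>k. x k \<in> X\<^sub>0"
    "\<And>y \<epsilon> K. \<epsilon> > 0 \<Longrightarrow> \<exists>k\<ge>K. dist (x k) y < \<epsilon>"
proof -
  obtain C :: "'a set" where C: "countable C" "closure C = UNIV"
    using sep by (auto simp: separable_space_def)
  have "C \<noteq> {}" using C by force
  have "\<exists>p\<in>X\<^sub>0. dist p c < 1 / (real n + 1)" for c and n :: nat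
    using dense closure_approachable[of c X\<^sub>0] by simp
  then obtain p where p: "\<And>c n. p c n \<in> X\<^sub>0" "\<And>c (n::nat). dist (p c n) c < 1 / (real n + 1)"
    by metis
  define x where "x k = p (from_nat_into C (fst (prod_decode k))) (snd (prod_decode k))" for k
  show ?thesis
  proof (rule that[of x])
    show "x k \<in> X\<^sub>0" for k using p by (simp add: x_def)
    fix y :: 'a and \<epsilon> :: real and K :: nat assume \<epsilon>: "\<epsilon> > 0"
    then obtain c where c: "c \<in> C" "dist c y < \<epsilon> / 2"
      using C closure_approachable[of y C] by (metis UNIV_I half_gt_zero)
    obtain i where i: "from_nat_into C i = c" using from_nat_into_surj[OF C(1) c(1)] by blast
    obtain n0 :: nat where n0: "2 / \<epsilon> \<le> real n0" using real_arch_simple by blast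
    define n where "n = max n0 K"
    have "2 / \<epsilon> < real n + 1" using n0 by (simp add: n_def)
    then have "1 / (real n + 1) < \<epsilon> / 2" using \<epsilon> by (simp add: field_simps)
    then have "dist (p c n) c < \<epsilon> / 2" using p(2)[of c n] by linarith
    then have "dist (x (prod_encode (i, n))) y < \<epsilon>"
      using c(2) dist_triangle[of "p c n" y c] by (simp add: x_def i)
    moreover have "K \<le> prod_encode (i, n)"
      using le_prod_encode_2[of n i] by (simp add: n_def)
    ultimately show "\<exists>k\<ge>K. dist (x k) y < \<epsilon>" by blast
  qed
qed

lemma norm_sum_le_slices:
  fixes f :: "'i \<times> 'j \<Rightarrow> 'b::real_normed_vector"
  assumes "finite F"
  shows "norm (sum f F) \<le> (\<Sum>l\<in>fst ` F. norm (\<Sum>\<mu>\<in>F `` {l}. f (l, \<mu>)))"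
proof -
  have "F = (SIGMA l:fst ` F. F `` {l})"
    by (auto intro: rev_image_eqI)
  then have "sum f F = (\<Sum>l\<in>fst ` F. \<Sum>\<mu>\<in>F `` {l}. f (l, \<mu>))"
    using sum.Sigma[of "fst ` F" "\<lambda>l. F `` {l}" "\<lambda>l \<mu>. f (l, \<mu>)"] assms
    by (simp add: finite_Image)
  then show ?thesis by (simp add: norm_sum)
qed

lemma geometric_finite_sum_le: 
  assumes "finite L" shows "(\<Sum>l\<in>L. (1/2::real) ^ l) \<le> 2"
proof -
  have "(\<Sum>l\<in>L. (1/2::real) ^ l) \<le> (\<Sum>l. (1/2) ^ l)"
    by (rule sum_le_suminf) (auto simp: assms summable_geometric)
  also have "\<dots> = 2" using suminf_geometric[of "1/2::real"] by simp
  finally show ?thesis .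
qed

text \<open>The form in which the summability condition is used: one operator \<open>T t\<close>, a fixed point
  \<open>t\<close>, and a \<open>1\<close>-separated set of points \<open>\<mu>\<close> far from \<open>t\<close>. The differences \<open>t - \<mu>\<close> inherit the
  separation of the points \<open>\<mu>\<close>.\<close>

lemma separated_sum_norms_bound:
  assumes "Sup (separated_sum_norms \<Delta> T S r x) < ereal \<epsilon>"
    and "finite F" "F \<subseteq> \<Delta>" "t \<in> \<Delta>" "\<And>\<mu>. \<mu> \<in> F \<Longrightarrow> r \<le> cmod (t - \<mu>)"
    and sep: "\<And>\<mu> \<nu>. \<mu> \<in> F \<Longrightarrow> \<nu> \<in> F \<Longrightarrow> \<mu> \<noteq> \<nu> \<Longrightarrow> 1 \<le> cmod (\<mu> - \<nu>)"
  shows "norm (\<Sum>\<mu>\<in>F. T t (S \<mu> x)) < \<epsilon>"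
proof -
  obtain h where h: "bij_betw h {0..<card F} F"
    using ex_bij_betw_nat_finite[OF \<open>finite F\<close>] by blast
  have hF: "h n \<in> F" if "n < card F" for n using h that by (auto simp: bij_betw_def)
  have eq: "(\<Sum>\<mu>\<in>F. T t (S \<mu> x)) = (\<Sum>n\<in>{0..<card F}. T t (S (h n) x))"
    using sum.reindex_bij_betw[OF h, of "\<lambda>\<mu>. T t (S \<mu> x)"] by simp
  have "ereal (norm (\<Sum>\<mu>\<in>F. T t (S \<mu> x))) \<in> separated_sum_norms \<Delta> T S r x"
    unfolding separated_sum_norms_def mem_Collect_eq eq
  proof (intro exI conjI ballI impI)
    show "ereal (norm (\<Sum>n\<in>{0..<card F}. T t (S (h n) x)))
        = ereal (norm (\<Sum>n\<in>{0..<card F}. T ((\<lambda>_. t) n) (S (h n) x)))" by simp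
    fix n m assume nm: "n \<in> {0..<card F}" "m \<in> {0..<card F}" "n \<noteq> m"
    then have "h m \<noteq> h n" using h by (auto simp: bij_betw_def inj_on_def)
    then have "1 \<le> cmod (h m - h n)" using nm hF by (intro sep) auto
    then show "1 \<le> cmod ((t - h n) - (t - h m))" by simp
  qed (use hF assms in auto)
  then have "ereal (norm (\<Sum>\<mu>\<in>F. T t (S \<mu> x))) < ereal \<epsilon>"
    using assms(1) Sup_upper le_less_trans by blast
  then show ?thesis by simp
qed

lemma inverse_four_power_max_le: "(1/4::real) ^ max k l \<le> (1/2) ^ k * (1/2) ^ l"
proof -
  have "(1/4::real) ^ max k l = (1/2) ^ (2 * max k l)" by (simp add: power_mult power2_eq_square)
  also have "\<dots> \<le> (1/2) ^ (k + l)" by (rule power_decreasing) auto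
  finally show ?thesis by (simp add: power_add)
qed

section \<open>The frequent hypercyclicity criterion\<close>

theorem theorem2p1:
  fixes \<alpha> :: real
    and \<Delta> :: "complex set"
    and T S :: "complex \<Rightarrow> 'a \<Rightarrow> 'a::banach"
    and X\<^sub>0 :: "'a set"
  assumes "0 < \<alpha>" and "\<alpha> \<le> pi / 2"
    and "\<Delta> = sector \<alpha>"
    and "separable_space (euclidean :: 'a topology)"
    and "C0_semigroup \<Delta> T"
    and "closure X\<^sub>0 = UNIV"
    and "\<And>x \<epsilon>. x \<in> X\<^sub>0 \<Longrightarrow> (\<epsilon>::real) > 0 \<Longrightarrow>
           \<exists>r>0. Sup (separated_sum_norms \<Delta> T S r x) < ereal \<epsilon>"
    and "\<And>x. x \<in> X\<^sub>0 \<Longrightarrow>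
           ((\<lambda>t. T t (S t x)) \<longlongrightarrow> x) (inf at_infinity (principal \<Delta>))"
  shows "frequently_hypercyclic \<Delta> T"
proof -
  note \<alpha> = assms(1,2) and \<Delta> = assms(3) and sep = assms(4) and T = assms(5) and dense = assms(6)
    and small = assms(7) and inv = assms(8)
  have lin: "bounded_linear (T t)" if "t \<in> \<Delta>" for t
    using T that by (simp add: C0_semigroup_def)
  have T0: "T 0 y = y" for y using T by (simp add: C0_semigroup_def)
  have T_add: "T (t + s) y = T s (T t y)" if "t \<in> \<Delta>" "s \<in> \<Delta>" for t s y
  proof -
    have "T (s + t) = T s \<circ> T t" using T that by (simp add: C0_semigroup_def)
    then show ?thesis by (simp add: add.commute)
  qed
  have T_cont: "((\<lambda>s. T s y) \<longlongrightarrow> T t y) (at t within \<Delta>)" if "t \<in> \<Delta>" for t y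
    using T that by (simp add: C0_semigroup_def)
  then have T_cont_on: "continuous_on \<Delta> (\<lambda>s. T s y)" for y
    by (simp add: continuous_on_def)
  have closed: "closed \<Delta>" and zero: "0 \<in> \<Delta>"
    using closed_sector[OF \<alpha>] zero_in_sector[OF \<alpha>] by (auto simp: \<Delta>)
  have add: "z + w \<in> \<Delta>" if "z \<in> \<Delta>" "w \<in> \<Delta>" for z w
    using sector_add[OF \<alpha>] that by (simp add: \<Delta>)

  \<comment> \<open>Needed to move from the discrete times \<open>z \<in> A k\<close> to the times \<open>z + s\<close> nearby.\<close>
  obtain M where M: "M > 0" "\<And>s y. s \<in> \<Delta> \<inter> cball 0 1 \<Longrightarrow> norm (T s y) \<le> M * norm y"
  proof (rule uniform_boundedness_principle[of "\<Delta> \<inter> cball 0 1" T])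
    show "\<exists>C. \<forall>s\<in>\<Delta> \<inter> cball 0 1. norm (T s y) \<le> C" for y
    proof -
      have "compact ((\<lambda>s. T s y) ` (\<Delta> \<inter> cball 0 1))"
        by (intro compact_continuous_image continuous_on_subset[OF T_cont_on]
            closed_Int_compact closed) auto
      then show ?thesis using compact_imp_bounded bounded_iff by (metis image_eqI)
    qed
  qed (use lin in auto)

  \<comment> \<open>The targets that the orbit has to approach.\<close>
  obtain x :: "nat \<Rightarrow> 'a" where xX: "\<And>k. x k \<in> X\<^sub>0"
    and x: "\<And>y \<epsilon> K. \<epsilon> > 0 \<Longrightarrow> \<exists>k\<ge>K. dist (x k) y < \<epsilon>"
    using separable_dense_sequence[OF sep dense] by metis

  \<comment> \<open>At level \<open>k\<close> the distance \<open>N k\<close> has to serve all targets \<open>x i\<close> with \<open>i \<le> k\<close> with error \<open>4 ^ - k\<close>.\<close>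
  have "\<exists>r. \<forall>k i. 0 < r k i \<and> Sup (separated_sum_norms \<Delta> T S (r k i) (x i)) < ereal ((1/4) ^ k)"
    using small[OF xX] by (intro choice allI) auto
  then obtain r where r: "\<And>k i. 0 < r k i"
    "\<And>k i. Sup (separated_sum_norms \<Delta> T S (r k i) (x i)) < ereal ((1/4) ^ k)" by blast
  have "\<exists>b. \<forall>t\<in>\<Delta>. b \<le> cmod t \<longrightarrow> norm (T t (S t (x k)) - x k) \<le> (1/2) ^ k" for k
  proof -
    have "\<forall>\<^sub>F t in inf at_infinity (principal \<Delta>). dist (T t (S t (x k))) (x k) < (1/2) ^ k"
      using inv[OF xX] by (rule tendstoD) simp
    then show ?thesis
      unfolding eventually_inf_principal eventually_at_infinity dist_norm by (meson less_imp_le)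
  qed
  then obtain b where b: "\<And>k t. t \<in> \<Delta> \<Longrightarrow> b k \<le> cmod t \<Longrightarrow> norm (T t (S t (x k)) - x k) \<le> (1/2) ^ k"
    by metis
  define N where "N k = Max (insert (b k) (r k ` {..k}))" for k
  have N_b: "b k \<le> N k" for k by (simp add: N_def)
  have N_r: "r k i \<le> N k" if "i \<le> k" for k i
    unfolding N_def by (rule Max_ge) (use that in auto)
  have N_pos: "0 < N k" for k using N_r[of k k] r(1)[of k k] by simp

  \<comment> \<open>The additional \<open>1\<close> absorbs the displacement \<open>s\<close> with \<open>\<bar>s\<bar> \<le> 1\<close>.\<close>
  obtain A where A: "\<And>k z. z \<in> A k \<Longrightarrow> 0 \<le> Im z \<and> Im z \<le> sin \<alpha> * Re z \<and> N k + 1 \<le> Re z"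
    "\<And>k l z w. z \<in> A k \<Longrightarrow> w \<in> A l \<Longrightarrow> (k, z) \<noteq> (l, w) \<Longrightarrow> (N k + 1) + (N l + 1) \<le> cmod (z - w)"
    "\<And>k R. finite {z \<in> A k. cmod z \<le> R}"
    "\<And>k. \<exists>d>0. \<forall>\<^sub>F R in at_top. d * R\<^sup>2 \<le> real (card {z \<in> A k. cmod z \<le> R})"
    by (rule separated_planar_sets_exist[of "sin \<alpha>" "\<lambda>k. N k + 1"])
      (use sector_sin_pos[OF \<alpha>] N_pos in \<open>auto intro: add_pos_pos\<close>)
  have A_\<Delta>: "A k \<subseteq> \<Delta>" for k
    using A(1) in_sectorI[OF \<alpha>] by (force simp: \<Delta>)
  have A_norm: "N k \<le> cmod z" if "z \<in> A k" for k z
    using A(1)[OF that] complex_Re_le_cmod[of z] by linarith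

  define I where "I = (SIGMA k:UNIV. A k)"
  define f where "f = (\<lambda>(l, \<mu>). S \<mu> (x l))"
  \<comment> \<open>The contributions with label \<open>l\<close> have norm at most \<open>4 ^ - max k l \<le> 2 ^ - k * 2 ^ - l\<close>, which is summable over \<open>l\<close>.\<close>
  have key: "norm (\<Sum>p\<in>F. T t (f p)) \<le> 2 * (1/2) ^ k"
    if t: "t \<in> \<Delta>" and F: "finite F" "F \<subseteq> I"
      and far: "\<And>l \<mu>. (l, \<mu>) \<in> F \<Longrightarrow> N (max k l) \<le> cmod (t - \<mu>)" for t F k
  proof -
    have "norm (\<Sum>\<mu>\<in>F `` {l}. T t (S \<mu> (x l))) \<le> (1/2) ^ k * (1/2) ^ l" for l
    proof -
      have "norm (\<Sum>\<mu>\<in>F `` {l}. T t (S \<mu> (x l))) < (1/4) ^ max k l"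
      proof (rule separated_sum_norms_bound[OF r(2)])
        show "F `` {l} \<subseteq> \<Delta>" using F A_\<Delta> by (auto simp: I_def)
        show "r (max k l) l \<le> cmod (t - \<mu>)" if "\<mu> \<in> F `` {l}" for \<mu>
          using far[of l \<mu>] N_r[of l "max k l"] that by simp
        show "1 \<le> cmod (\<mu> - \<nu>)" if "\<mu> \<in> F `` {l}" "\<nu> \<in> F `` {l}" "\<mu> \<noteq> \<nu>" for \<mu> \<nu>
          using A(2)[of \<mu> l \<nu> l] that F(2) N_pos[of l] by (force simp: I_def)
      qed (use F t in \<open>auto simp: finite_Image\<close>)
      then show ?thesis using inverse_four_power_max_le[of k l] by linarith
    qed
    then have "(\<Sum>l\<in>fst ` F. norm (\<Sum>\<mu>\<in>F `` {l}. T t (f (l, \<mu>)))) \<le> (\<Sum>l\<in>fst ` F. (1/2) ^ k * (1/2) ^ l)"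
      by (intro sum_mono) (simp add: f_def)
    also have "\<dots> = (1/2) ^ k * (\<Sum>l\<in>fst ` F. (1/2) ^ l)" by (simp add: sum_distrib_left)
    also have "\<dots> \<le> (1/2) ^ k * 2"
      by (intro mult_left_mono geometric_finite_sum_le) (use F in auto)
    finally show ?thesis using norm_sum_le_slices[OF F(1), of "\<lambda>p. T t (f p)"] by simp
  qed

  \<comment> \<open>The estimate at time \<open>0\<close>: outside the finite set \<open>F\<^sub>0\<close> all points are far enough from \<open>0\<close>.\<close>
  have summable: "f summable_on I"
  proof (rule summable_on_Cauchy_criterion)
    fix \<epsilon> :: real assume "\<epsilon> > 0"
    then obtain k where k: "(1/2) ^ k < \<epsilon> / 2"
      using real_arch_pow_inv[of "\<epsilon> / 2" "1/2"] by auto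
    define F\<^sub>0 where "F\<^sub>0 = (SIGMA l:{..k}. {z \<in> A l. cmod z \<le> N k})"
    have "norm (sum f F) < \<epsilon>" if F: "finite F" "F \<subseteq> I - F\<^sub>0" for F
    proof -
      have "norm (\<Sum>p\<in>F. T 0 (f p)) \<le> 2 * (1/2) ^ k"
      proof (rule key[OF zero])
        fix l \<mu> assume lm: "(l, \<mu>) \<in> F"
        then have "\<mu> \<in> A l" and "(l, \<mu>) \<notin> F\<^sub>0" using F by (auto simp: I_def)
        then show "N (max k l) \<le> cmod (0 - \<mu>)"
          using A_norm[of \<mu> l] by (cases "l \<le> k") (auto simp: F\<^sub>0_def max_def)
      qed (use F in auto)
      then show ?thesis using k by (simp add: T0)
    qed
    moreover have "finite F\<^sub>0" using A(3) by (auto simp: F\<^sub>0_def)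
    moreover have "F\<^sub>0 \<subseteq> I" by (auto simp: F\<^sub>0_def I_def)
    ultimately show "\<exists>F\<^sub>0. finite F\<^sub>0 \<and> F\<^sub>0 \<subseteq> I \<and> (\<forall>F. finite F \<and> F \<subseteq> I - F\<^sub>0 \<longrightarrow> norm (sum f F) < \<epsilon>)"
      by (intro exI[of _ F\<^sub>0]) simp
  qed
  define h where "h = infsum f I"

  \<comment> \<open>Near a time \<open>z \<in> A k\<close> the summand belonging to \<open>z\<close> reproduces \<open>x k\<close>, and all other points are far from \<open>z + s\<close>.\<close>
  have orbit: "norm (T (z + s) h - x k) \<le> (M + 2) * (1/2) ^ k + norm (T s (x k) - x k)"
    if z: "z \<in> A k" and s: "s \<in> \<Delta>" "cmod s \<le> 1" for k z s
  proof -
    have z\<Delta>: "z \<in> \<Delta>" using z A_\<Delta> by auto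
    have t: "z + s \<in> \<Delta>" using add[OF z\<Delta> s(1)] .
    interpret Ts: bounded_linear "T s" by (rule lin[OF s(1)])
    let ?g = "\<lambda>p. T (z + s) (f p)"
    let ?I = "I - {(k, z)}"
    have sum: "?g summable_on I" by (rule summable_on_bounded_linear[OF lin[OF t] summable])
    then have sum': "?g summable_on ?I" by (rule summable_on_subset_banach) auto
    have kz: "(k, z) \<in> I" using z by (simp add: I_def)
    have "T (z + s) h = infsum ?g I"
      unfolding h_def
      using infsumI[OF has_sum_bounded_linear[OF lin[OF t] has_sum_infsum[OF summable]]] by simp
    also have "\<dots> = infsum ?g ({(k, z)} \<union> ?I)" using kz by (simp add: insert_absorb)
    also have "\<dots> = infsum ?g {(k, z)} + infsum ?g ?I"
      by (rule infsum_Un_disjoint) (auto simp: sum')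
    also have "infsum ?g {(k, z)} = T s (T z (S z (x k)))"
      using T_add[OF z\<Delta> s(1)] by (simp add: f_def)
    finally have eq: "T (z + s) h - x k =
        T s (T z (S z (x k)) - x k) + infsum ?g ?I + (T s (x k) - x k)"
      by (simp add: Ts.diff)
    have "norm (infsum ?g ?I) \<le> 2 * (1/2) ^ k"
    proof (rule norm_infsum_le_of_finite_sums[OF sum'])
      fix F assume F: "finite F" "F \<subseteq> ?I"
      show "norm (sum ?g F) \<le> 2 * (1/2) ^ k"
      proof (rule key[OF t])
        fix l \<mu> assume "(l, \<mu>) \<in> F"
        then have "\<mu> \<in> A l" "(k, z) \<noteq> (l, \<mu>)" using F by (auto simp: I_def)
        then have "(N k + 1) + (N l + 1) \<le> cmod (z - \<mu>)" using A(2)[OF z] by blast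
        moreover have "cmod (z - \<mu>) \<le> cmod (z + s - \<mu>) + cmod s"
          using norm_triangle_ineq4[of "z + s - \<mu>" s] by simp
        ultimately show "N (max k l) \<le> cmod (z + s - \<mu>)"
          using s N_pos[of k] N_pos[of l] by (simp add: max_def)
      qed (use F in auto)
    qed
    moreover have "norm (T s (T z (S z (x k)) - x k)) \<le> M * (1/2) ^ k"
    proof -
      have "norm (T s (T z (S z (x k)) - x k)) \<le> M * norm (T z (S z (x k)) - x k)"
        using M(2)[of s] s by simp
      also have "\<dots> \<le> M * (1/2) ^ k"
        using M(1) b[OF z\<Delta>, of k] N_b[of k] A_norm[OF z] by (intro mult_left_mono) auto
      finally show ?thesis .
    qed
    moreover have "norm (T (z + s) h - x k) \<le>
        norm (T s (T z (S z (x k)) - x k)) + norm (infsum ?g ?I) + norm (T s (x k) - x k)"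
      unfolding eq by (meson add_mono norm_triangle_ineq norm_triangle_le order_refl)
    ultimately show ?thesis by (simp add: algebra_simps)
  qed

  have "lower_density \<Delta> {t \<in> \<Delta>. T t h \<in> U} > 0" if U: "open U" "U \<noteq> {}" for U
  proof -
    obtain y \<rho> where y: "\<rho> > 0" "ball y \<rho> \<subseteq> U" using U by (meson ex_in_conv openE)
    obtain K where "(1/2) ^ K < \<rho> / 3 / (M + 2)"
      using real_arch_pow_inv[of "\<rho> / 3 / (M + 2)" "1/2"] y M(1) by auto
    then have K: "(M + 2) * (1/2) ^ K < \<rho> / 3" using M(1) by (simp add: field_simps)
    obtain k where k: "k \<ge> K" "dist (x k) y < \<rho> / 3" using x[of "\<rho> / 3" K y] y by auto
    have "(M + 2) * (1/2) ^ k \<le> (M + 2) * (1/2) ^ K"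
      using M(1) k(1) by (intro mult_left_mono power_decreasing) auto
    then have k_small: "(M + 2) * (1/2) ^ k < \<rho> / 3" using K by linarith
    have "\<forall>\<^sub>F s in at 0 within \<Delta>. dist (T s (x k)) (T 0 (x k)) < \<rho> / 3"
      using T_cont[OF zero] by (rule tendstoD) (use y in simp)
    then obtain \<delta>' where \<delta>': "\<delta>' > 0"
      "\<And>s. s \<in> \<Delta> \<Longrightarrow> s \<noteq> 0 \<Longrightarrow> cmod s < \<delta>' \<Longrightarrow> dist (T s (x k)) (T 0 (x k)) < \<rho> / 3"
      unfolding eventually_at by auto
    define \<delta> where "\<delta> = min 1 (\<delta>' / 2)"
    have \<delta>: "0 < \<delta>" "\<delta> \<le> 1" "\<delta> < \<delta>'" using \<delta>' by (auto simp: \<delta>_def)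
    have near: "norm (T s (x k) - x k) < \<rho> / 3" if "s \<in> \<Delta>" "cmod s \<le> \<delta>" for s
      using \<delta>'(2)[OF that(1)] that(2) \<delta>(3) y(1) by (cases "s = 0") (auto simp: T0 dist_norm)
    have visits: "z + s \<in> {t \<in> \<Delta>. T t h \<in> U}" if "z \<in> A k" "s \<in> sector \<alpha>" "cmod s \<le> \<delta>" for z s
    proof -
      have s: "s \<in> \<Delta>" "cmod s \<le> 1" using that \<delta> by (auto simp: \<Delta>)
      have "norm (T (z + s) h - x k) < \<rho> / 3 + \<rho> / 3"
        using orbit[OF that(1) s] near[OF s(1) that(3)] k_small by linarith
      then have "dist y (T (z + s) h) < \<rho>"
        using k(2) dist_triangle[of y "T (z + s) h" "x k"]
        by (simp add: dist_norm norm_minus_commute)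
      then show ?thesis using y(2) add[of z s] A_\<Delta> that(1) s(1) by auto
    qed
    obtain d where d: "d > 0" "\<forall>\<^sub>F R in at_top. d * R\<^sup>2 \<le> real (card {z \<in> A k. cmod z \<le> R})"
      using A(4) by blast
    \<comment> \<open>Measurability is essential here: \<^const>\<open>measure\<close> is \<open>0\<close> on sets that are not measurable.\<close>
    have "{t \<in> \<Delta>. T t h \<in> U} \<in> sets lebesgue"
    proof -
      obtain V where "open V" "{t \<in> \<Delta>. T t h \<in> U} = \<Delta> \<inter> V"
        using continuous_openin_preimage_gen[OF T_cont_on U(1), of h]
        by (auto simp: openin_open vimage_def Collect_conj_eq)
      then show ?thesis using closed by simp
    qed
    then have "lower_density (sector \<alpha>) {t \<in> \<Delta>. T t h \<in> U} > 0"
      by (rule lower_density_pos_of_separated_translates[OF \<alpha> _ _ A(3) _ d \<delta>(1,2) visits])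
        (use A_\<Delta> A(2)[of _ k _ k] N_pos[of k] in \<open>force simp: \<Delta>\<close>)+
    then show ?thesis by (simp add: \<Delta>)
  qed
  then show ?thesis unfolding frequently_hypercyclic_def by blast
qed

end
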